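(* Let $k$ be a positive integer and $n\geqslant 0$ an integer. Then $$(-1)^{k-1}\left(\sum_{j=-(k-1)}^{k}(-1)^j\,\sigma\,\mathrm{mex}\big(n-j(3j-1)/2\big)-\delta(n)\right)=\sum_{j=0}^{\infty}M_k\big(n-j(j+1)/2\big).$$
   Context: For a partition $\lambda$, $\mathrm{mex}(\lambda)$ (the minimal excludant) is the smallest positive integer that is not a part of $\lambda$ (so the empty partition has mex $1$). For an integer $m\geqslant 0$, $\sigma\,\mathrm{mex}(m)=\sum_{\lambda}\mathrm{mex}(\lambda)$, the sum over all partitions $\lambda$ of $m$; $\sigma\,\mathrm{mex}(m)=0$ for $m<0$. $\delta(n)=1$ if $n=m(m+1)/2$ for some integer $m$, and $\delta(n)=0$ otherwise. For a positive integer $k$, $M_k(m)$ is the number of partitions of $m$ in which $k$ is the least positive integer that is not a part and there are more parts $>k$ than there are parts $<k$; $M_k(m)=0$ for $m<0$. *)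

theory Defs
  imports Complex_Main "HOL-Library.Multiset"
begin

text \<open>
  Partitions are multisets of positive integers. The argument is an integer, so that there
  are no partitions of a negative number and everything below vanishes there.
\<close>

definition partitions :: "int \<Rightarrow> nat multiset set" where
  "partitions m = {p. 0 \<notin># p \<and> int (sum_mset p) = m}"

lemma finite_partitions: "finite (partitions m)"
proof (rule finite_subset)
  show "partitions m \<subseteq> mset ` {xs. set xs \<subseteq> {..nat m} \<and> length xs \<le> nat m}"
  proof
    fix p assume "p \<in> partitions m"
    then have p: "0 \<notin># p" "sum_mset p = nat m"
      by (auto simp: partitions_def simp del: of_nat_sum_mset)
    obtain xs where xs: "p = mset xs"
      by (metis ex_mset)
    have "length ys \<le> sum_list ys" if "0 \<notin> set ys" for ys :: "nat list"
      using that by (induction ys) auto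
    from this[of xs] have "length xs \<le> nat m"
      using p xs by (simp add: sum_mset_sum_list)
    moreover have "set xs \<subseteq> {..nat m}"
      using p xs by (auto simp: sum_mset_sum_list dest: member_le_sum_list)
    ultimately show "p \<in> mset ` {xs. set xs \<subseteq> {..nat m} \<and> length xs \<le> nat m}"
      using xs by blast
  qed
  show "finite (mset ` {xs. set xs \<subseteq> {..nat m} \<and> length xs \<le> nat m})"
    by (intro finite_imageI finite_lists_length_le) simp
qed

lemma partitions_neg: "m < 0 \<Longrightarrow> partitions m = {}"
  by (auto simp: partitions_def simp del: of_nat_sum_mset)

definition mex :: "nat multiset \<Rightarrow> nat" where
  "mex p = (LEAST i. 0 < i \<and> i \<notin># p)"

definition sigma_mex :: "int \<Rightarrow> nat" where
  "sigma_mex m = (\<Sum>p\<in>partitions m. mex p)"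

text \<open>The division is exact, as \<open>m * (m + 1)\<close> is even.\<close>

definition delta :: "int \<Rightarrow> int" where
  "delta n = (if \<exists>m::int. n = m * (m + 1) div 2 then 1 else 0)"

text \<open>Parts are counted with multiplicity.\<close>

definition M :: "nat \<Rightarrow> int \<Rightarrow> nat" where
  "M k m = card {p \<in> partitions m. mex p = k \<and>
     size {#i \<in># p. i < k#} < size {#i \<in># p. k < i#}}"

end

theory Submission
  imports Defs "HOL-Computational_Algebra.Formal_Power_Series"
begin

text \<open>
  As \<open>mex p\<close> is the number of \<open>i \<ge> 0\<close> such that \<open>1, \<dots>, i\<close> are parts of \<open>p\<close>, we have
  \<open>\<sigma>mex(m) = \<Sum>i. p(m - i(i+1)/2)\<close>. So the theorem is the sum over the triangular numbers of the
  truncated pentagonal number theorem of Andrews and Merca, and \<open>\<delta>\<close> collects its correction terms.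
  The latter theorem follows by induction on \<open>k\<close> from
  \<open>M\<^sub>k(n) + M\<^sub>k\<^sub>+\<^sub>1(n) = p(n - k(3k+1)/2) - p(n - (k+1)(3k+2)/2)\<close>. For this, write \<open>(q)\<^sub>s\<close> for the product
  of the \<open>1 - q\<^sup>i\<close> with \<open>1 \<le> i \<le> s\<close> and sort the partitions by the number \<open>k + s\<close> of large parts.
  The partitions with \<open>t\<close> parts, all at least \<open>a\<close>, have the generating function
  \<open>q\<^sup>a\<^sup>t / (q)\<^sub>t\<close>, and small parts are counted by Gaussian binomial coefficients.
  For fixed \<open>s\<close>, the contributions to \<open>M\<^sub>k\<close> and \<open>M\<^sub>k\<^sub>+\<^sub>1\<close> add up, apart from factors independent of
  \<open>s\<close>, to \<open>((1 - q\<^sup>k) q\<^bsup>(k+1)s\<^esup> + q\<^sup>k q\<^bsup>(k+2)s\<^esup>) / (q)\<^sub>s\<close>, so that the sum over \<open>s\<close> is a combination of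
  the generating functions of all partitions into parts above \<open>k\<close> and above \<open>k + 1\<close>.
\<close>

section \<open>Generating functions of sets of partitions\<close>

definition npartitions :: "nat \<Rightarrow> nat multiset set" where
  "npartitions n = {p. 0 \<notin># p \<and> sum_mset p = n}"

lemma partitions_int: "partitions (int n) = npartitions n"
  by (simp add: partitions_def npartitions_def del: of_nat_sum_mset)

lemma finite_npartitions: "finite (npartitions n)"
  using finite_partitions[of "int n"] by (simp add: partitions_int)

lemma mem_npartitions: "p \<in> npartitions n \<longleftrightarrow> 0 \<notin># p \<and> sum_mset p = n"
  by (simp add: npartitions_def)

lemma size_le_sum_mset: "0 \<notin># p \<Longrightarrow> size p \<le> sum_mset p" for p :: "nat multiset"
  by (induction p) auto

text \<open>Intersecting with \<open>npartitions n\<close> discards multisets that contain 0. So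
  \<open>A\<close> may have such members, and \<open>gf UNIV\<close> is the series of all partition
  numbers.\<close>

definition gf :: "nat multiset set \<Rightarrow> int fps" where
  "gf A = Abs_fps (\<lambda>n. int (card (A \<inter> npartitions n)))"

lemma gf_nth: "fps_nth (gf A) n = int (card (A \<inter> npartitions n))"
  by (simp add: gf_def)

lemma gf_cong: "(\<And>p. 0 \<notin># p \<Longrightarrow> p \<in> A \<longleftrightarrow> p \<in> B) \<Longrightarrow> gf A = gf B"
  unfolding gf_def
  by (rule arg_cong[where f = Abs_fps], rule ext,
      intro arg_cong[where f = int] arg_cong[where f = card]) (auto simp: mem_npartitions)

lemma gf_empty: "gf {} = 0"
  by (rule fps_ext) (simp add: gf_nth)

lemma gf_singleton_empty: "gf {{#}} = 1"
proof (rule fps_ext)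
  fix n
  have "{{#}} \<inter> npartitions n = (if n = 0 then {{#}} else {})"
    by (auto simp: mem_npartitions)
  then show "fps_nth (gf {{#}}) n = fps_nth 1 n"
    by (simp add: gf_nth)
qed

lemma gf_Un:
  assumes "A \<inter> B = {}"
  shows "gf (A \<union> B) = gf A + gf B"
proof (rule fps_ext)
  fix n
  have "card ((A \<union> B) \<inter> npartitions n)
      = card (A \<inter> npartitions n) + card (B \<inter> npartitions n)"
    unfolding Int_Un_distrib2 using assms
    by (intro card_Un_disjoint) (auto simp: finite_npartitions)
  then show "fps_nth (gf (A \<union> B)) n = fps_nth (gf A + gf B) n"
    by (simp add: gf_nth)
qed

lemma gf_image:
  assumes "inj_on f A"
    and f: "\<And>p. p \<in> A \<Longrightarrow> 0 \<notin># p \<Longrightarrow> sum_mset (f p) = sum_mset p + c"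
    and z: "\<And>p. p \<in> A \<Longrightarrow> 0 \<in># f p \<longleftrightarrow> 0 \<in># p"
  shows "gf (f ` A) = fps_X ^ c * gf A"
proof (rule fps_ext)
  fix n
  show "fps_nth (gf (f ` A)) n = fps_nth (fps_X ^ c * gf A) n"
  proof (cases "n < c")
    case True
    then have "f ` A \<inter> npartitions n = {}"
      using f z by (force simp: mem_npartitions)
    with True show ?thesis
      by (simp add: gf_nth fps_X_power_mult_nth)
  next
    case False
    then have "f p \<in> npartitions n \<longleftrightarrow> p \<in> npartitions (n - c)" if "p \<in> A" for p
      using f[OF that] z[OF that] by (auto simp: mem_npartitions)
    then have "f ` A \<inter> npartitions n = f ` (A \<inter> npartitions (n - c))"
      by blast
    moreover have "inj_on f (A \<inter> npartitions (n - c))"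
      using assms(1) by (rule inj_on_subset) auto
    ultimately show ?thesis
      using False by (simp add: gf_nth fps_X_power_mult_nth card_image)
  qed
qed

text \<open>Taking out one copy of \<open>a\<close> is injective on the members that contain
  \<open>a\<close> and lowers the sum by \<open>a\<close>. The recurrences for restricted parts
  start from this.\<close>

lemma gf_remove_part:
  assumes "a > 0"
  shows "gf A = gf {p \<in> A. a \<notin># p} + fps_X ^ a * gf {r. add_mset a r \<in> A}"
proof -
  have "A = {p \<in> A. a \<notin># p} \<union> add_mset a ` {r. add_mset a r \<in> A}" (is "_ = ?B \<union> ?C")
    by (auto simp: image_iff dest: multi_member_split)
  then have "gf A = gf (?B \<union> ?C)"
    by simp
  also have "\<dots> = gf ?B + gf ?C"
    by (rule gf_Un) auto
  also have "gf ?C = fps_X ^ a * gf {r. add_mset a r \<in> A}"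
    by (rule gf_image) (use assms in \<open>auto simp: inj_on_def\<close>)
  finally show ?thesis .
qed

text \<open>Injectivity makes the decomposition unique, so sorting by the sum of the first component
  gives the Cauchy product.\<close>

lemma gf_sum:
  assumes "inj_on (\<lambda>(p, r). p + r) (A \<times> B)"
  shows "gf ((\<lambda>(p, r). p + r) ` (A \<times> B)) = gf A * gf B"
proof (rule fps_ext)
  fix n
  let ?f = "\<lambda>(p :: nat multiset, r). p + r"
  let ?C = "\<lambda>i. (A \<inter> npartitions i) \<times> (B \<inter> npartitions (n - i))"
  have eq: "?f ` (A \<times> B) \<inter> npartitions n = ?f ` (\<Union>i\<in>{0..n}. ?C i)" (is "?l = ?r")
  proof
    show "?l \<subseteq> ?r"
    proof
      fix x assume "x \<in> ?l"
      then obtain p r where x: "x = p + r" "p \<in> A" "r \<in> B" "0 \<notin># p + r" "sum_mset (p + r) = n"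
        by (auto simp: mem_npartitions)
      then have "(p, r) \<in> ?C (sum_mset p)" "sum_mset p \<le> n"
        by (auto simp: mem_npartitions)
      then show "x \<in> ?r"
        using x(1) by (intro image_eqI[of _ _ "(p, r)"]) auto
    qed
    show "?r \<subseteq> ?l"
      by (auto simp: mem_npartitions)
  qed
  have "inj_on ?f (\<Union>i\<in>{0..n}. ?C i)"
    using assms by (rule inj_on_subset) auto
  then have "card (?f ` (A \<times> B) \<inter> npartitions n) = card (\<Union>i\<in>{0..n}. ?C i)"
    unfolding eq by (rule card_image)
  also have "\<dots> = (\<Sum>i\<in>{0..n}. card (?C i))"
    by (rule card_UN_disjoint)
      (auto simp: finite_npartitions mem_npartitions)
  finally show "fps_nth (gf (?f ` (A \<times> B))) n = fps_nth (gf A * gf B) n"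
    by (simp add: gf_nth fps_mult_nth card_cartesian_product)
qed

section \<open>Sums of series of increasing order\<close>

text \<open>
  The sum of the series \<open>T t\<close>, provided that \<open>T t\<close> has order at least \<open>t\<close>.
\<close>

definition fsum :: "(nat \<Rightarrow> 'a::comm_ring_1 fps) \<Rightarrow> 'a fps" where
  "fsum T = Abs_fps (\<lambda>n. \<Sum>t\<le>n. fps_nth (T t) n)"

lemma fsum_add: "fsum (\<lambda>t. S t + T t) = fsum S + fsum T"
  by (rule fps_ext) (simp add: fsum_def sum.distrib)

lemma fsum_mult:
  assumes "\<And>t n. n < t \<Longrightarrow> fps_nth (T t) n = 0"
  shows "fsum (\<lambda>t. c * T t) = c * fsum T"
proof (rule fps_ext)
  fix n
  have "fps_nth (c * fsum T) n
      = (\<Sum>i=0..n. fps_nth c i * (\<Sum>t\<le>n - i. fps_nth (T t) (n - i)))"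
    by (simp add: fps_mult_nth fsum_def)
  \<comment> \<open>As \<open>T t\<close> has order at least \<open>t\<close>, the range
    \<open>t \<le> n - i\<close> extends to \<open>t \<le> n\<close>, which is independent of
    \<open>i\<close>, and the sums can be swapped.\<close>
  also have "\<dots> = (\<Sum>i=0..n. fps_nth c i * (\<Sum>t\<le>n. fps_nth (T t) (n - i)))"
    by (intro sum.cong refl arg_cong2[where f = "(*)"] sum.mono_neutral_left)
      (auto simp: assms)
  also have "\<dots> = (\<Sum>t\<le>n. \<Sum>i=0..n. fps_nth c i * fps_nth (T t) (n - i))"
    unfolding sum_distrib_left by (rule sum.swap)
  also have "\<dots> = fps_nth (fsum (\<lambda>t. c * T t)) n"
    by (simp add: fps_mult_nth fsum_def)
  finally show "fps_nth (fsum (\<lambda>t. c * T t)) n = fps_nth (c * fsum T) n" ..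
qed

lemma gf_nth_eq_0:
  assumes "\<And>p. p \<in> A \<Longrightarrow> t \<le> size p" "n < t"
  shows "fps_nth (gf A) n = 0"
proof -
  have "A \<inter> npartitions n = {}"
    using assms size_le_sum_mset by (fastforce simp: mem_npartitions)
  then show ?thesis
    by (simp add: gf_nth)
qed

text \<open>A partition of \<open>n\<close> has at most \<open>n\<close> parts, so it can only lie
  in an \<open>A t\<close> with \<open>t \<le> n\<close>.\<close>

lemma gf_UN:
  assumes "\<And>t p. p \<in> A t \<Longrightarrow> t \<le> size p"
    and "\<And>s t. s \<noteq> t \<Longrightarrow> A s \<inter> A t = {}"
  shows "gf (\<Union>t. A t) = fsum (\<lambda>t. gf (A t))"
proof (rule fps_ext)
  fix n
  have "(\<Union>t. A t) \<inter> npartitions n = (\<Union>t\<in>{..n}. A t \<inter> npartitions n)"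
    using assms(1) size_le_sum_mset by (fastforce simp: mem_npartitions)
  then have "card ((\<Union>t. A t) \<inter> npartitions n) = (\<Sum>t\<le>n. card (A t \<inter> npartitions n))"
    using assms(2) by (simp del: Int_UN_distrib2 UN_simps, intro card_UN_disjoint)
      (auto simp: finite_npartitions)
  then show "fps_nth (gf (\<Union>t. A t)) n = fps_nth (fsum (\<lambda>t. gf (A t))) n"
    by (simp add: gf_nth fsum_def)
qed

section \<open>Partitions with restricted parts\<close>

definition qfact :: "nat \<Rightarrow> int fps" where
  "qfact n = (\<Prod>i=1..n. 1 - fps_X ^ i)"

lemma qfact_0: "qfact 0 = 1"
  by (simp add: qfact_def)

lemma qfact_Suc: "qfact (Suc n) = (1 - fps_X ^ Suc n) * qfact n"
  by (simp add: qfact_def mult.commute)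

lemma one_minus_X_power_nonzero: "n > 0 \<Longrightarrow> (1 - fps_X ^ n :: int fps) \<noteq> 0"
proof
  assume n: "n > 0" and "(1 - fps_X ^ n :: int fps) = 0"
  then have "fps_nth (1 - fps_X ^ n :: int fps) 0 = 0"
    by simp
  with n show False
    by simp
qed

text \<open>Identities with denominators are stated multiplied out; this fact allows cancelling
  \<open>qfact n\<close> in the integral domain of integer power series.\<close>

lemma qfact_nonzero: "qfact n \<noteq> 0"
  by (auto simp: qfact_def one_minus_X_power_nonzero simp del: right_minus_eq)

definition large_parts :: "nat \<Rightarrow> nat multiset set" where
  "large_parts a = {p. \<forall>i\<in>#p. a \<le> i}"

lemma gf_large_parts:
  assumes "a > 0"
  shows "gf (large_parts a) * (1 - fps_X ^ a) = gf (large_parts (Suc a))"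
proof -
  have "{p \<in> large_parts a. a \<notin># p} = large_parts (Suc a)"
       "{r. add_mset a r \<in> large_parts a} = large_parts a"
    by (auto simp: large_parts_def Suc_le_eq le_less)
  then show ?thesis
    using gf_remove_part[OF assms, of "large_parts a"] by (simp add: algebra_simps)
qed

text \<open>Each factor \<open>1 - fps_X ^ i\<close> forbids the part \<open>i\<close>.\<close>

lemma gf_large_parts_qfact:
  "gf (large_parts (Suc 0)) * qfact k = gf (large_parts (Suc k))"
proof (induction k)
  case (Suc k)
  have "gf (large_parts (Suc 0)) * qfact (Suc k)
      = (gf (large_parts (Suc 0)) * qfact k) * (1 - fps_X ^ Suc k)"
    by (simp add: qfact_Suc mult_ac)
  then show ?case
    using Suc gf_large_parts[of "Suc k"] by simp
qed (simp add: qfact_0)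

definition large_parts_size :: "nat \<Rightarrow> nat \<Rightarrow> nat multiset set" where
  "large_parts_size a t = {p \<in> large_parts a. size p = t}"

lemma large_parts_size_Suc: "large_parts_size (Suc a) t = image_mset Suc ` large_parts_size a t"
proof (intro equalityI subsetI)
  fix p assume p: "p \<in> large_parts_size (Suc a) t"
  have "image_mset Suc (image_mset (\<lambda>i. i - 1) p) = image_mset (\<lambda>i. i) p"
    unfolding multiset.map_comp using p
    by (intro image_mset_cong) (force simp: large_parts_size_def large_parts_def)
  moreover have "image_mset (\<lambda>i. i - 1) p \<in> large_parts_size a t"
    using p by (force simp: large_parts_size_def large_parts_def)
  ultimately show "p \<in> image_mset Suc ` large_parts_size a t"
    by (metis image_eqI image_mset.identity id_apply multiset.map_ident)
qed (auto simp: large_parts_size_def large_parts_def)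

lemma gf_large_parts_size_Suc:
  assumes "a > 0"
  shows "gf (large_parts_size (Suc a) t) = fps_X ^ t * gf (large_parts_size a t)"
  unfolding large_parts_size_Suc
proof (rule gf_image)
  show "inj_on (image_mset Suc) (large_parts_size a t)"
    by (rule inj_on_inverseI[of _ "image_mset (\<lambda>i. i - 1)"])
      (simp add: multiset.map_comp comp_def)
  fix p assume "p \<in> large_parts_size a t"
  moreover have "sum_mset (image_mset Suc p) = sum_mset p + size p"
    by (induction p) auto
  ultimately show "sum_mset (image_mset Suc p) = sum_mset p + t" "0 \<in># image_mset Suc p \<longleftrightarrow> 0 \<in># p"
    using assms by (auto simp: large_parts_size_def large_parts_def)
qed

lemma gf_large_parts_size_remove:
  assumes "a > 0"
  shows "gf (large_parts_size a (Suc t))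
    = gf (large_parts_size (Suc a) (Suc t)) + fps_X ^ a * gf (large_parts_size a t)"
proof -
  have "{p \<in> large_parts_size a (Suc t). a \<notin># p} = large_parts_size (Suc a) (Suc t)"
       "{r. add_mset a r \<in> large_parts_size a (Suc t)} = large_parts_size a t"
    by (auto simp: large_parts_size_def large_parts_def Suc_le_eq le_less)
  then show ?thesis
    using gf_remove_part[OF assms, of "large_parts_size a (Suc t)"] by simp
qed

text \<open>Let \<open>F t\<close> be the series. Either \<open>a\<close> occurs and one copy is
  removed, or 1 is subtracted from every part. Hence
  \<open>F (t+1) = X^a * F t + X^(t+1) * F (t+1)\<close>, which is solved for
  \<open>F (t+1)\<close>.\<close>

lemma gf_large_parts_size:
  assumes "a > 0"
  shows "gf (large_parts_size a t) * qfact t = fps_X ^ (a * t)"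
proof (induction t)
  case 0
  have "large_parts_size a 0 = {{#}}"
    by (auto simp: large_parts_size_def large_parts_def)
  then show ?case
    by (simp add: gf_singleton_empty qfact_0)
next
  case (Suc t)
  have "gf (large_parts_size a (Suc t)) * (1 - fps_X ^ Suc t)
      = fps_X ^ a * gf (large_parts_size a t)"
    using gf_large_parts_size_remove[OF assms, of t] gf_large_parts_size_Suc[OF assms, of "Suc t"]
    by (simp add: algebra_simps)
  then have "gf (large_parts_size a (Suc t)) * qfact (Suc t)
      = fps_X ^ a * (gf (large_parts_size a t) * qfact t)"
    by (simp add: qfact_Suc mult.assoc[symmetric])
  then show ?case
    by (simp add: Suc power_add)
qed

lemma fsum_large_parts_size: "fsum (\<lambda>t. gf (large_parts_size a t)) = gf (large_parts a)"
proof -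
  have "large_parts a = (\<Union>t. large_parts_size a t)"
    by (auto simp: large_parts_size_def)
  moreover have "gf (\<Union>t. large_parts_size a t) = fsum (\<lambda>t. gf (large_parts_size a t))"
    by (rule gf_UN) (auto simp: large_parts_size_def)
  ultimately show ?thesis
    by simp
qed

section \<open>Gaussian binomial coefficients and partitions in which all of 1, ..., m occur\<close>

definition small_parts :: "nat \<Rightarrow> nat \<Rightarrow> nat multiset set" where
  "small_parts m s = {p. (\<forall>i\<in>#p. 1 \<le> i \<and> i \<le> m) \<and> size p \<le> s}"

text \<open>The q-Pascal rule: sort by whether the largest admissible part occurs.\<close>

lemma gf_small_parts_Suc:
  "gf (small_parts (Suc m) (Suc s))
    = gf (small_parts m (Suc s)) + fps_X ^ Suc m * gf (small_parts (Suc m) s)"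
proof -
  have "{p \<in> small_parts (Suc m) (Suc s). Suc m \<notin># p} = small_parts m (Suc s)"
       "{r. add_mset (Suc m) r \<in> small_parts (Suc m) (Suc s)} = small_parts (Suc m) s"
    by (auto simp: small_parts_def le_Suc_eq)
  then show ?thesis
    using gf_remove_part[of "Suc m" "small_parts (Suc m) (Suc s)"] by simp
qed

text \<open>The Gaussian binomial coefficient of \<open>m + s\<close> over \<open>m\<close>,
  multiplied out. The q-Pascal rule lowers either \<open>m\<close> or \<open>s\<close>, hence an
  induction on \<open>s\<close> inside the one on \<open>m\<close>.\<close>

lemma gf_small_parts: "gf (small_parts m s) * (qfact m * qfact s) = qfact (m + s)"
proof (induction m arbitrary: s)
  case 0
  have "small_parts 0 s = {{#}}"
    by (auto simp: small_parts_def intro: multiset_nonemptyE)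
  then show ?case
    by (simp add: gf_singleton_empty qfact_0)
next
  case (Suc m)
  note IH = Suc
  show ?case
  proof (induction s)
    case 0
    have "small_parts (Suc m) 0 = {{#}}"
      by (auto simp: small_parts_def)
    then show ?case
      by (simp add: gf_singleton_empty qfact_0)
  next
    case (Suc s)
    have "gf (small_parts (Suc m) (Suc s)) * (qfact (Suc m) * qfact (Suc s))
        = (1 - fps_X ^ Suc m) * (gf (small_parts m (Suc s)) * (qfact m * qfact (Suc s)))
          + fps_X ^ Suc m * (1 - fps_X ^ Suc s)
            * (gf (small_parts (Suc m) s) * (qfact (Suc m) * qfact s))"
      unfolding gf_small_parts_Suc by (simp only: qfact_Suc) (simp add: algebra_simps)
    also have "\<dots> = ((1 - fps_X ^ Suc m) + fps_X ^ Suc m * (1 - fps_X ^ Suc s)) * qfact (Suc (m + s))"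
      unfolding IH Suc by (simp add: distrib_right)
    also have "\<dots> = (1 - fps_X ^ (Suc m + Suc s)) * qfact (Suc (m + s))"
      by (simp only: power_add) (simp add: algebra_simps)
    also have "\<dots> = qfact (Suc m + Suc s)"
      by (simp add: qfact_Suc)
    finally show ?case .
  qed
qed

definition full_parts :: "nat \<Rightarrow> nat \<Rightarrow> nat multiset set" where
  "full_parts m t = {p. set_mset p = {1..m} \<and> size p < t}"

lemma sum_mset_mset_set: "sum_mset (mset_set A) = \<Sum>A"
  by (simp add: sum_unfold_sum_mset)

lemma mset_set_msubset: "A \<subseteq> set_mset p \<Longrightarrow> mset_set A \<subseteq># p"
  by (meson finite_set_mset mset_set_set_mset_msubset subset_imp_msubset_mset_set
      subset_mset.order_trans)

text \<open>Remove one copy of each of 1, ..., m. Having fewer than \<open>Suc m + s\<close> parts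
  means that at most \<open>s\<close> parts remain.\<close>

lemma full_parts_eq: "full_parts m (Suc m + s) = (+) (mset_set {1..m}) ` small_parts m s"
proof (intro equalityI subsetI)
  fix p assume p: "p \<in> full_parts m (Suc m + s)"
  then have "mset_set {1..m} \<subseteq># p"
    by (simp add: full_parts_def mset_set_msubset)
  then obtain r where "p = mset_set {1..m} + r"
    by (metis subset_mset.less_eqE)
  moreover from this p have "r \<in> small_parts m s"
    by (auto simp: full_parts_def small_parts_def)
  ultimately show "p \<in> (+) (mset_set {1..m}) ` small_parts m s"
    by blast
qed (auto simp: full_parts_def small_parts_def)

lemma gf_full_parts:
  "gf (full_parts m (Suc m + s)) * (qfact m * qfact s) = fps_X ^ (\<Sum>{1..m}) * qfact (m + s)"
proof -
  have "gf (full_parts m (Suc m + s)) = fps_X ^ (\<Sum>{1..m}) * gf (small_parts m s)"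
    unfolding full_parts_eq by (rule gf_image) (auto simp: sum_mset_mset_set)
  then show ?thesis
    using gf_small_parts[of m s] by (simp add: mult.assoc)
qed

lemma full_parts_empty:
  assumes "t \<le> m"
  shows "full_parts m t = {}"
proof (rule equals0I)
  fix p assume "p \<in> full_parts m t"
  then have p: "set_mset p = {1..m}" "size p < t"
    by (auto simp: full_parts_def)
  then have "m \<le> size p"
    using size_mset_mono[OF mset_set_set_mset_msubset[of p]] by simp
  with p assms show False
    by simp
qed

text \<open>The size bound is that of \<open>gf_full_parts\<close>, but with one more prescribed
  part only \<open>s - 1\<close> free parts remain. The factor \<open>1 - fps_X ^ s\<close> turns
  \<open>qfact (s - 1)\<close> into \<open>qfact s\<close> and gives 0 at \<open>s = 0\<close>,
  where the set is empty.\<close>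

lemma gf_full_parts':
  "gf (full_parts (Suc m) (Suc m + s)) * (qfact (Suc m) * qfact s)
    = fps_X ^ (\<Sum>{1..Suc m}) * ((1 - fps_X ^ s) * qfact (m + s))"
proof (cases s)
  case 0
  then show ?thesis
    by (simp add: full_parts_empty gf_empty)
next
  case (Suc s')
  have "gf (full_parts (Suc m) (Suc m + s)) * (qfact (Suc m) * qfact s)
      = (1 - fps_X ^ s) * (gf (full_parts (Suc m) (Suc (Suc m) + s')) * (qfact (Suc m) * qfact s'))"
    using Suc by (simp add: qfact_Suc[of s'] mult_ac)
  also have "\<dots> = fps_X ^ (\<Sum>{1..Suc m}) * ((1 - fps_X ^ s) * qfact (m + s))"
    unfolding gf_full_parts using Suc by (simp only: mult_ac add_Suc add_Suc_right)
  finally show ?thesis .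
qed

section \<open>The recurrence for the numbers M\<close>

definition mex_parts :: "nat \<Rightarrow> nat multiset set" where
  "mex_parts k = {p. mex p = k \<and> size {#i \<in># p. i < k#} < size {#i \<in># p. k < i#}}"

lemma M_eq: "M k x = card (mex_parts k \<inter> partitions x)"
  unfolding M_def mex_parts_def by (rule arg_cong[where f = card]) auto

lemma mex_props: "0 < mex p" "mex p \<notin># p" "0 < i \<Longrightarrow> i < mex p \<Longrightarrow> i \<in># p"
proof -
  have "\<exists>i. 0 < i \<and> i \<notin># p"
    using ex_new_if_finite[of "insert 0 (set_mset p)"] by auto
  from LeastI_ex[OF this] show "0 < mex p" "mex p \<notin># p"
    unfolding mex_def by auto
  show "0 < i \<Longrightarrow> i < mex p \<Longrightarrow> i \<in># p"
    unfolding mex_def by (auto dest: not_less_Least)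
qed

lemma mex_eq_iff: "mex p = Suc m \<longleftrightarrow> {1..m} \<subseteq> set_mset p \<and> Suc m \<notin># p"
proof
  assume "mex p = Suc m"
  then show "{1..m} \<subseteq> set_mset p \<and> Suc m \<notin># p"
    using mex_props(1,2)[of p] mex_props(3)[of _ p] by auto
next
  assume "{1..m} \<subseteq> set_mset p \<and> Suc m \<notin># p"
  then show "mex p = Suc m"
    unfolding mex_def
    by (intro Least_equality) (auto simp: subset_iff not_less_eq_eq[symmetric])
qed

text \<open>
  Here \<open>t\<close> is the number of parts above the minimal excludant \<open>m + 1\<close>.
\<close>

definition split_parts :: "nat \<Rightarrow> nat \<Rightarrow> nat multiset set" where
  "split_parts m t = (\<lambda>(p, r). p + r) ` (full_parts m t \<times> large_parts_size (m + 2) t)"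

text \<open>Both halves are recovered from the sum. This yields injectivity for the product formula
  and disjointness for different \<open>t\<close>.\<close>

lemma filter_split_parts:
  assumes "p \<in> full_parts m t" "r \<in> large_parts_size (m + 2) t"
  shows "{#i \<in># p + r. i < Suc m#} = p" "{#i \<in># p + r. Suc m < i#} = r"
proof -
  have "{#i \<in># p. i < Suc m#} = p" "{#i \<in># r. i < Suc m#} = {#}"
       "{#i \<in># p. Suc m < i#} = {#}" "{#i \<in># r. Suc m < i#} = r"
    using assms
    by (force simp: full_parts_def large_parts_size_def large_parts_def filter_mset_eq_conv)+
  then show "{#i \<in># p + r. i < Suc m#} = p" "{#i \<in># p + r. Suc m < i#} = r"
    by simp_all
qed

lemma gf_split_parts:
  "gf (split_parts m t) = gf (full_parts m t) * gf (large_parts_size (m + 2) t)"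
  unfolding split_parts_def
proof (rule gf_sum, rule inj_onI)
  fix u v
  assume "u \<in> full_parts m t \<times> large_parts_size (m + 2) t"
    "v \<in> full_parts m t \<times> large_parts_size (m + 2) t"
    "(case u of (p, r) \<Rightarrow> p + r) = (case v of (p, r) \<Rightarrow> p + r)"
  then show "u = v"
    using filter_split_parts[of "fst u" m t "snd u"] filter_split_parts[of "fst v" m t "snd v"]
    by (auto simp: case_prod_unfold prod_eq_iff)
qed

text \<open>Cut the partition at its minimal excludant and let \<open>t\<close> count the parts
  above it; the condition on the sizes becomes the bound \<open>t\<close> in
  \<open>full_parts\<close>.\<close>

lemma mex_parts_eq:
  assumes "0 \<notin># p"
  shows "p \<in> mex_parts (Suc m) \<longleftrightarrow> (\<exists>t. p \<in> split_parts m t)"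
proof
  assume p: "p \<in> mex_parts (Suc m)"
  let ?u = "{#i \<in># p. i < Suc m#}" and ?v = "{#i \<in># p. Suc m < i#}"
  have mex: "{1..m} \<subseteq> set_mset p" "Suc m \<notin># p"
    using p by (auto simp: mex_parts_def mex_eq_iff)
  have "{#i \<in># p. \<not> i < Suc m#} = ?v"
    using mex by (intro filter_mset_cong) (auto simp: not_less le_less)
  then have "p = ?u + ?v"
    using multiset_partition[of p "\<lambda>i. i < Suc m"] by simp
  moreover have "?u \<in> full_parts m (size ?v)"
    using p mex assms unfolding full_parts_def mex_parts_def
    by (auto simp: less_Suc_eq_le Suc_le_eq intro!: gr0I)
  moreover have "?v \<in> large_parts_size (m + 2) (size ?v)"
    by (auto simp: large_parts_size_def large_parts_def)
  ultimately show "\<exists>t. p \<in> split_parts m t"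
    unfolding split_parts_def by (metis (no_types, lifting) SigmaI image_eqI prod.case)
next
  assume "\<exists>t. p \<in> split_parts m t"
  then obtain t u v where uv: "u \<in> full_parts m t" "v \<in> large_parts_size (m + 2) t" "p = u + v"
    by (auto simp: split_parts_def)
  then have "mex p = Suc m"
    by (auto simp: mex_eq_iff full_parts_def large_parts_size_def large_parts_def)
  moreover have "size u < size v"
    using uv by (auto simp: full_parts_def large_parts_size_def)
  ultimately show "p \<in> mex_parts (Suc m)"
    using filter_split_parts[OF uv(1,2)] by (simp add: mex_parts_def uv(3))
qed

text \<open>\<open>split_parts m t\<close> is empty for \<open>t \<le> m\<close>, so the sum may
  start at any \<open>c \<le> Suc m\<close>. This lets the sums for two consecutive excludants start
  at the same index.\<close>

lemma gf_mex_parts: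
  assumes "c \<le> Suc m"
  shows "gf (mex_parts (Suc m)) = fsum (\<lambda>s. gf (split_parts m (c + s)))"
proof -
  have "gf (mex_parts (Suc m)) = gf (\<Union>s. split_parts m (c + s))"
  proof (rule gf_cong)
    fix p :: "nat multiset" assume "0 \<notin># p"
    moreover have "c \<le> t" if "p \<in> split_parts m t" for t
      using that full_parts_empty[of t m] assms by (fastforce simp: split_parts_def)
    ultimately show "p \<in> mex_parts (Suc m) \<longleftrightarrow> p \<in> (\<Union>s. split_parts m (c + s))"
      by (auto simp: mex_parts_eq dest: le_Suc_ex)
  qed
  also have "\<dots> = fsum (\<lambda>s. gf (split_parts m (c + s)))"
  proof (rule gf_UN)
    have size: "size {#i \<in># p. Suc m < i#} = t" if "p \<in> split_parts m t" for p t
      using that filter_split_parts(2) by (force simp: split_parts_def large_parts_size_def)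
    show "s \<noteq> t \<Longrightarrow> split_parts m (c + s) \<inter> split_parts m (c + t) = {}" for s t
      using size by (metis add_left_cancel disjoint_iff)
    show "t \<le> size p" if "p \<in> split_parts m (c + t)" for t p
      using size[OF that] size_filter_mset_lesseq[of "\<lambda>i. Suc m < i" p] by simp
  qed
  finally show ?thesis .
qed

text \<open>The algebra behind \<open>gf_split_parts_add\<close>, where \<open>x * y\<close> is
  \<open>fps_X ^ (a + s)\<close> and \<open>Q\<close> is \<open>qfact (m + s)\<close>.\<close>

lemma split_identity:
  fixes x y z :: "'a::comm_ring_1"
  assumes a: "qa = (1 - x) * qm"
    and F1: "F1 * (qm * qs) = z * Q" and F2: "F2 * (qa * qs) = z * x * ((1 - y) * Q)"
    and L1: "L1 * (1 - x * y) * Q = C * w" and L2: "L2 * (1 - x * y) * Q = C * w * x * y"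
    and K1: "K1 * qs = w" and K2: "K2 * qs = w * y"
  shows "qa * (F1 * L1 + F2 * L2) * (qs * (1 - x * y) * Q)
    = z * C * ((1 - x) * K1 + x * K2) * (qs * (1 - x * y) * Q)"
proof -
  define d where "d = 1 - x * y"
  have "qa * (F1 * L1 + F2 * L2) * (qs * d * Q)
      = (1 - x) * (F1 * (qm * qs)) * (L1 * d * Q) + (F2 * (qa * qs)) * (L2 * d * Q)"
    by (simp only: distrib_left distrib_right mult_ac a)
  also have "\<dots> = (1 - x) * (z * Q) * (C * w) + (z * x * ((1 - y) * Q)) * (C * w * x * y)"
    unfolding F1 F2 L1 L2 d_def ..
  \<comment> \<open>The denominator \<open>d\<close> splits off because \<open>(1 - x) + x^2 * y *
    (1 - y) = (1 - x * y) * ((1 - x) + x * y)\<close>.\<close>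
  also have "\<dots> = z * C * ((1 - x) * w + x * (w * y)) * (d * Q)"
    unfolding d_def by (simp add: algebra_simps)
  also have "\<dots> = z * C * ((1 - x) * (K1 * qs) + x * (K2 * qs)) * (d * Q)"
    unfolding K1 K2 ..
  also have "\<dots> = z * C * ((1 - x) * K1 + x * K2) * (qs * d * Q)"
    by (simp only: distrib_left distrib_right mult_ac)
  finally show ?thesis
    unfolding d_def .
qed

text \<open>
  Both summands have the denominator \<open>1 - X ^ (a + s)\<close>, which cancels in the sum; what remains can
  be summed over \<open>s\<close>.
\<close>

lemma gf_split_parts_add:
  assumes "a = Suc m"
  shows "qfact a * (gf (split_parts m (a + s)) + gf (split_parts a (a + s)))
    = fps_X ^ (\<Sum>{1..m} + a * (a + 1)) *
      ((1 - fps_X ^ a) * gf (large_parts_size (a + 1) s) + fps_X ^ a * gf (large_parts_size (a + 2) s))"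
    (is "?l = ?r")
proof -
  let ?D = "qfact s * (1 - fps_X ^ (a + s))" and ?Q = "qfact (m + s)"
  define F1 F2 L1 L2 where "F1 = gf (full_parts m (a + s))" and "F2 = gf (full_parts a (a + s))"
    and "L1 = gf (large_parts_size (a + 1) (a + s))" and "L2 = gf (large_parts_size (a + 2) (a + s))"
  define x y z :: "int fps" where "x = fps_X ^ a" and "y = fps_X ^ s" and "z = fps_X ^ (\<Sum>{1..m})"
  have Q: "qfact (a + s) = (1 - x * y) * ?Q" and a: "qfact a = (1 - x) * qfact m"
    using qfact_Suc[of "m + s"] qfact_Suc[of m] assms by (simp_all add: x_def y_def power_add)
  have F1: "F1 * (qfact m * qfact s) = z * ?Q"
    using gf_full_parts[of m s] by (simp add: F1_def z_def assms)
  have F2: "F2 * (qfact a * qfact s) = z * x * ((1 - y) * ?Q)"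
    using gf_full_parts'[of m s] by (simp add: F2_def z_def assms x_def y_def power_add mult_ac)
  have L1: "L1 * ((1 - x * y) * ?Q) = fps_X ^ ((a + 1) * (a + s))"
    using gf_large_parts_size[of "a + 1" "a + s"] by (simp add: Q L1_def)
  have L2: "L2 * ((1 - x * y) * ?Q) = fps_X ^ ((a + 2) * (a + s))"
    using gf_large_parts_size[of "a + 2" "a + s"] by (simp add: Q L2_def)
  have nz: "qfact s * (1 - x * y) * ?Q \<noteq> 0"
    using one_minus_X_power_nonzero[of "a + s"] assms
    by (auto simp: qfact_nonzero x_def y_def power_add mult.assoc simp del: right_minus_eq)
  \<comment> \<open>The exponent is split into a part free of \<open>s\<close> and
    \<open>(a + 1) * s\<close>, the exponent for \<open>s\<close> parts of size at least
    \<open>a + 1\<close>.\<close>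
  have L1': "L1 * (1 - x * y) * ?Q = fps_X ^ (a * (a + 1)) * fps_X ^ ((a + 1) * s)"
  proof -
    have "(a + 1) * (a + s) = a * (a + 1) + (a + 1) * s"
      by (simp add: algebra_simps)
    then show ?thesis
      using L1 by (simp only: power_add mult.assoc)
  qed
  have L2': "L2 * (1 - x * y) * ?Q = fps_X ^ (a * (a + 1)) * fps_X ^ ((a + 1) * s) * x * y"
  proof -
    have "(a + 2) * (a + s) = a * (a + 1) + (a + 1) * s + a + s"
      by (simp add: algebra_simps)
    then show ?thesis
      using L2 by (simp only: x_def y_def power_add mult.assoc)
  qed
  define C w K1 K2 where "C = (fps_X ^ (a * (a + 1)) :: int fps)"
    and "w = (fps_X ^ ((a + 1) * s) :: int fps)"
    and "K1 = gf (large_parts_size (a + 1) s)" and "K2 = gf (large_parts_size (a + 2) s)"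
  have K1: "K1 * qfact s = w"
    using gf_large_parts_size[of "a + 1" s] by (simp add: K1_def w_def)
  have K2: "K2 * qfact s = w * y"
  proof -
    have "(a + 2) * s = (a + 1) * s + s"
      by (simp add: algebra_simps)
    then show ?thesis
      using gf_large_parts_size[of "a + 2" s]
      by (simp only: K2_def w_def y_def power_add)
  qed
  have "qfact a * (F1 * L1 + F2 * L2) = z * C * ((1 - x) * K1 + x * K2)"
    using split_identity[OF a F1 F2 L1'[folded C_def w_def] L2'[folded C_def w_def] K1 K2] nz
    by simp
  then show ?thesis
    unfolding gf_split_parts F1_def F2_def L1_def L2_def K1_def K2_def x_def z_def C_def
    by (simp add: power_add assms)
qed

text \<open>Sum \<open>gf_split_parts_add\<close> over \<open>s\<close>. The exponent is the
  pentagonal number \<open>a * (3 * a + 1) / 2\<close>, and \<open>2 * a + 1\<close> is its distance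
  to \<open>(a + 1) * (3 * a + 2) / 2\<close>.\<close>

lemma gf_mex_parts_add:
  assumes "a = Suc m"
  shows "gf (mex_parts a) + gf (mex_parts (Suc a))
    = fps_X ^ (\<Sum>{1..m} + a * (a + 1)) * (1 - fps_X ^ (2 * a + 1)) * gf UNIV"
proof -
  define E :: "int fps" where "E = fps_X ^ (\<Sum>{1..m} + a * (a + 1))"
  define S T where "S = (\<lambda>s. gf (split_parts m (a + s)))" and "T = (\<lambda>s. gf (split_parts a (a + s)))"
  define K L where "K = (\<lambda>s. gf (large_parts_size (a + 1) s))"
    and "L = (\<lambda>s. gf (large_parts_size (a + 2) s))"
  have size: "t \<le> size p" if "p \<in> split_parts b (a + t)" for p t b
    using that by (auto simp: split_parts_def large_parts_size_def)
  have order: "fps_nth (K s) n = 0" "fps_nth (L s) n = 0" if "n < s" for s n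
    unfolding K_def L_def using that
    by (auto simp: large_parts_size_def intro!: gf_nth_eq_0[of _ s n])
  have "qfact a * (gf (mex_parts a) + gf (mex_parts (Suc a))) = qfact a * fsum (\<lambda>s. S s + T s)"
    using gf_mex_parts[of a m] gf_mex_parts[of a a] by (simp add: fsum_add assms S_def T_def)
  also have "\<dots> = fsum (\<lambda>s. qfact a * (S s + T s))"
    by (rule fsum_mult[symmetric]) (simp add: S_def T_def gf_nth_eq_0[OF size])
  also have "\<dots> = fsum (\<lambda>s. E * (1 - fps_X ^ a) * K s + E * fps_X ^ a * L s)"
    unfolding S_def T_def gf_split_parts_add[OF assms] K_def L_def E_def
    by (simp only: distrib_left mult.assoc)
  also have "\<dots> = E * (1 - fps_X ^ a) * fsum K + E * fps_X ^ a * fsum L"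
    unfolding fsum_add by (intro arg_cong2[where f = "(+)"] fsum_mult) (simp_all add: order)
  also have "\<dots> = E * (1 - fps_X ^ a) * gf (large_parts (a + 1))
      + E * fps_X ^ a * (gf (large_parts (a + 1)) * (1 - fps_X ^ (a + 1)))"
    using gf_large_parts[of "a + 1"] by (simp add: K_def L_def fsum_large_parts_size)
  \<comment> \<open>Here \<open>(1 - X^a) + X^a * (1 - X^(a+1))\<close> telescopes.\<close>
  also have "\<dots> = E * (1 - fps_X ^ (2 * a + 1)) * gf (large_parts (Suc a))"
    by (simp add: mult_2 power_add) (simp add: algebra_simps)
  also have "\<dots> = qfact a * (E * (1 - fps_X ^ (2 * a + 1)) * gf (large_parts (Suc 0)))"
    unfolding gf_large_parts_qfact[of a, symmetric] by (simp only: mult_ac)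
  finally have "gf (mex_parts a) + gf (mex_parts (Suc a))
      = E * (1 - fps_X ^ (2 * a + 1)) * gf (large_parts (Suc 0))"
    by (simp only: mult_cancel_left qfact_nonzero simp_thms)
  moreover have "gf (large_parts (Suc 0)) = gf UNIV"
    by (rule gf_cong) (auto simp: large_parts_def Suc_le_eq intro: gr0I)
  ultimately show ?thesis
    by (simp add: E_def)
qed

text \<open>In a partition without the part 1 all parts exceed 1, so the size condition fails only
  for the empty partition; the summand 1 accounts for it.\<close>

lemma gf_mex_parts_1: "gf (mex_parts 1) + 1 = (1 - fps_X) * gf UNIV"
proof -
  have "gf (mex_parts 1) + 1 = gf (mex_parts 1 \<union> {{#}})"
    by (subst gf_Un) (auto simp: mex_parts_def gf_singleton_empty)
  also have "\<dots> = gf {p. 1 \<notin># p}"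
  proof (rule gf_cong)
    fix p :: "nat multiset" assume p: "0 \<notin># p"
    have "1 \<notin># p \<and> size {#i \<in># p. i < 1#} < size {#i \<in># p. 1 < i#}" if "1 \<notin># p" "p \<noteq> {#}"
    proof -
      have "1 < i" if "i \<in># p" for i
        using that p \<open>1 \<notin># p\<close> by (cases "i = 0"; cases "i = 1") auto
      then have "{#i \<in># p. i < 1#} = {#}" "{#i \<in># p. 1 < i#} = p"
        by (fastforce simp: filter_mset_eq_conv)+
      then show ?thesis
        using that by (simp only: nonempty_has_size size_empty simp_thms not_False_eq_True)
    qed
    then show "p \<in> mex_parts 1 \<union> {{#}} \<longleftrightarrow> p \<in> {p. 1 \<notin># p}"
      using mex_eq_iff[of p 0] by (auto simp: mex_parts_def)
  qed
  also have "\<dots> = (1 - fps_X) * gf UNIV"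
    using gf_remove_part[of 1 UNIV] by (simp add: algebra_simps)
  finally show ?thesis .
qed

section \<open>The truncated pentagonal number theorem\<close>

definition pcount :: "int \<Rightarrow> int" where
  "pcount x = int (card (partitions x))"

text \<open>Extending coefficients by 0 to negative indices makes the shift rule for
  \<open>fps_X ^ c\<close> hold at every integer.\<close>

definition coeff_int :: "int fps \<Rightarrow> int \<Rightarrow> int" where
  "coeff_int f x = (if x < 0 then 0 else fps_nth f (nat x))"

lemma coeff_int_gf: "coeff_int (gf A) x = int (card (A \<inter> partitions x))"
proof (cases "x < 0")
  case False
  then obtain n where "x = int n"
    using zero_le_imp_eq_int[of x] by (auto simp: not_less)
  then show ?thesis
    by (simp add: coeff_int_def gf_nth partitions_int)
qed (simp add: coeff_int_def partitions_neg)

lemma coeff_int_add: "coeff_int (f + g) x = coeff_int f x + coeff_int g x"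
  and coeff_int_diff: "coeff_int (f - g) x = coeff_int f x - coeff_int g x"
  and coeff_int_1: "coeff_int 1 x = (if x = 0 then 1 else 0)"
  by (simp_all add: coeff_int_def)

lemma coeff_int_X_power_mult: "coeff_int (fps_X ^ c * f) x = coeff_int f (x - int c)"
  by (auto simp: coeff_int_def fps_X_power_mult_nth nat_diff_distrib)

lemma coeff_int_UNIV: "coeff_int (gf UNIV) x = pcount x"
  by (simp add: coeff_int_gf pcount_def)

lemma M_1: "int (M 1 x) + (if x = 0 then 1 else 0) = pcount x - pcount (x - 1)"
proof -
  have "coeff_int (gf (mex_parts 1) + 1) x = coeff_int (gf UNIV - fps_X ^ 1 * gf UNIV) x"
    unfolding gf_mex_parts_1 by (simp add: left_diff_distrib)
  then show ?thesis
    unfolding coeff_int_add coeff_int_diff coeff_int_X_power_mult coeff_int_UNIV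
    by (simp add: coeff_int_gf M_eq coeff_int_1)
qed

text \<open>The shifts are the pentagonal numbers at \<open>j = -k\<close> and
  \<open>j = k + 1\<close>, the two indices that the truncated sum gains from \<open>k\<close> to
  \<open>k + 1\<close>.\<close>

lemma M_rec:
  assumes "k \<ge> 1"
  shows "int (M k x) + int (M (Suc k) x)
    = pcount (x - (- int k) * (3 * (- int k) - 1) div 2)
      - pcount (x - (int k + 1) * (3 * (int k + 1) - 1) div 2)"
proof -
  obtain m where m: "k = Suc m"
    using assms by (cases k) auto
  define e where "e = \<Sum>{1..m} + k * (k + 1)"
  have "2 * \<Sum>{1..n} = n * (n + 1)" for n :: nat
    by (induction n) auto
  from this[of m] have "2 * e = k * (3 * k + 1)"
    by (simp add: e_def m distrib_left)
  then have "int (2 * e) = int (k * (3 * k + 1))"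
    by (rule arg_cong)
  then have e: "2 * int e = int k * (3 * int k + 1)"
    by (simp only: of_nat_mult of_nat_add of_nat_numeral of_nat_1)
  then have "(- int k) * (3 * (- int k) - 1) = 2 * int e"
    by (simp add: algebra_simps)
  moreover from e have "(int k + 1) * (3 * (int k + 1) - 1) = 2 * int (e + (2 * k + 1))"
    by (simp add: algebra_simps)
  ultimately have pent: "(- int k) * (3 * (- int k) - 1) div 2 = int e"
    "(int k + 1) * (3 * (int k + 1) - 1) div 2 = int (e + (2 * k + 1))"
    by simp_all
  have "coeff_int (gf (mex_parts k) + gf (mex_parts (Suc k))) x
      = coeff_int (fps_X ^ e * gf UNIV - fps_X ^ (e + (2 * k + 1)) * gf UNIV) x"
    unfolding gf_mex_parts_add[OF m] e_def[symmetric]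
    by (simp only: right_diff_distrib left_diff_distrib power_add mult_1_right mult.assoc)
  then show ?thesis
    unfolding coeff_int_add coeff_int_diff coeff_int_X_power_mult coeff_int_UNIV pent
    by (simp add: coeff_int_gf M_eq)
qed

text \<open>In the induction step the two new terms have opposite signs and contribute
  \<open>(-1) ^ k * (M k x + M (Suc k) x)\<close>, whose first half cancels against the
  hypothesis.\<close>

lemma truncated_pentagonal:
  assumes "k \<ge> 1"
  shows "(\<Sum>j\<in>{- (int k - 1)..int k}. (-1) ^ nat \<bar>j\<bar> * pcount (x - j * (3 * j - 1) div 2))
    = (if x = 0 then 1 else 0) + (-1) ^ (k - 1) * int (M k x)"
  using assms
proof (induction k rule: nat_induct_at_least)
  case base
  have "{- (int 1 - 1)..int 1} = {0, 1}"
    by auto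
  then show ?case
    using M_1[of x] by simp
next
  case (Suc k)
  let ?f = "\<lambda>j. (-1) ^ nat \<bar>j\<bar> * pcount (x - j * (3 * j - 1) div 2)"
  have "{- (int (Suc k) - 1)..int (Suc k)} = {- int k, int k + 1} \<union> {- (int k - 1)..int k}"
    by auto
  then have "sum ?f {- (int (Suc k) - 1)..int (Suc k)}
      = sum ?f {- int k, int k + 1} + sum ?f {- (int k - 1)..int k}"
    by (simp only:) (rule sum.union_disjoint, auto)
  also have "sum ?f {- int k, int k + 1} = ?f (- int k) + ?f (int k + 1)"
    by simp
  also have "\<dots> = (-1) ^ k * (int (M k x) + int (M (Suc k) x))"
    unfolding M_rec[OF Suc.hyps] by (simp add: nat_add_distrib right_diff_distrib)
  finally show ?case
    unfolding Suc.IH using Suc.hyps by (cases k) (simp_all add: algebra_simps)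
qed

section \<open>Summation over the triangular numbers\<close>

lemma card_full_partitions:
  "int (card {p \<in> partitions x. {1..i} \<subseteq> set_mset p}) = pcount (x - int (i * (i + 1) div 2))"
proof -
  have "{p. {1..i} \<subseteq> set_mset p} = (+) (mset_set {1..i}) ` UNIV"
  proof (intro equalityI subsetI)
    fix p :: "nat multiset" assume p: "p \<in> {p. {1..i} \<subseteq> set_mset p}"
    then have "mset_set {1..i} \<subseteq># p"
      by (simp add: mset_set_msubset)
    then show "p \<in> (+) (mset_set {1..i}) ` UNIV"
      by (metis UNIV_I image_eqI subset_mset.less_eqE)
  qed auto
  moreover have "gf ((+) (mset_set {1..i}) ` UNIV) = fps_X ^ (\<Sum>{1..i}) * gf UNIV"
    by (rule gf_image) (auto simp: sum_mset_mset_set)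
  ultimately have "coeff_int (gf {p. {1..i} \<subseteq> set_mset p}) x = pcount (x - int (\<Sum>{1..i}))"
    by (simp only: coeff_int_X_power_mult coeff_int_UNIV)
  moreover have "\<Sum>{1..i} = i * (i + 1) div 2"
    by (induction i) auto
  moreover have "{p. {1..i} \<subseteq> set_mset p} \<inter> partitions x = {p \<in> partitions x. {1..i} \<subseteq> set_mset p}"
    by auto
  ultimately show ?thesis
    by (simp only: coeff_int_gf)
qed

lemma initial_interval_subset_iff: "{1..i} \<subseteq> set_mset p \<longleftrightarrow> i < mex p"
proof
  assume "{1..i} \<subseteq> set_mset p"
  then have "mex p \<notin> {1..i}"
    using mex_props(2)[of p] by blast
  then show "i < mex p"
    using mex_props(1)[of p] by auto
next
  assume "i < mex p"
  then show "{1..i} \<subseteq> set_mset p"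
    using mex_props(3)[of _ p] by auto
qed

text \<open>Count the \<open>i < mex p\<close> and swap the sums. All of them satisfy
  \<open>i \<le> size p \<le> x \<le> N\<close>; a free \<open>N\<close> allows one common range for
  all arguments in the theorem.\<close>

lemma sigma_mex_eq:
  assumes "x \<le> int N"
  shows "int (sigma_mex x) = (\<Sum>i\<le>N. pcount (x - int (i * (i + 1) div 2)))"
proof -
  have mex: "int (mex p) = (\<Sum>i\<le>N. if {1..i} \<subseteq> set_mset p then 1 else 0)" if "p \<in> partitions x" for p
  proof -
    obtain m where m: "mex p = Suc m"
      using mex_props(1)[of p] by (cases "mex p") auto
    then have "mset_set {1..m} \<subseteq># p"
      by (simp add: mset_set_msubset mex_eq_iff)
    then have "m \<le> size p"
      using size_mset_mono by fastforce
    moreover have "int (size p) \<le> x"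
      using that size_le_sum_mset[of p] by (auto simp: partitions_def simp del: of_nat_sum_mset)
    ultimately have "{i \<in> {..N}. i < mex p} = {..<mex p}"
      using m assms by auto
    then show ?thesis
      unfolding initial_interval_subset_iff by (simp add: sum.If_cases Int_def)
  qed
  have "int (sigma_mex x) = (\<Sum>p\<in>partitions x. \<Sum>i\<le>N. if {1..i} \<subseteq> set_mset p then 1 else 0)"
    unfolding sigma_mex_def of_nat_sum using mex by (rule sum.cong[OF refl])
  also have "\<dots> = (\<Sum>i\<le>N. \<Sum>p\<in>partitions x. if {1..i} \<subseteq> set_mset p then 1 else 0)"
    by (rule sum.swap)
  also have "\<dots> = (\<Sum>i\<le>N. int (card {p \<in> partitions x. {1..i} \<subseteq> set_mset p}))"
    by (simp add: sum.If_cases finite_partitions Int_def)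
  finally show ?thesis
    unfolding card_full_partitions .
qed

text \<open>Triangular numbers \<open>t i\<close> are strictly increasing with
  \<open>i \<le> t i\<close>, so at most one \<open>i\<close> contributes and it lies in the range.
  The summand is the correction term of \<open>truncated_pentagonal\<close>.\<close>

lemma delta_eq: "delta (int n) = (\<Sum>i\<le>n. if int n - int (i * (i + 1) div 2) = 0 then 1 else 0)"
proof -
  define t :: "nat \<Rightarrow> nat" where "t i = i * (i + 1) div 2" for i
  have t_Suc: "t (Suc i) = t i + Suc i" for i
    by (simp add: t_def)
  have le: "i \<le> t i" for i
    by (induction i) (auto simp: t_Suc)
  have "strict_mono t"
    by (rule strict_mono_Suc_iff[THEN iffD2]) (simp add: t_Suc)
  then have inj: "inj t"
    by (rule strict_mono_imp_inj_on)
  have eq: "(\<exists>m::int. int n = m * (m + 1) div 2) \<longleftrightarrow> (\<exists>i. n = t i)"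
  proof
    assume "\<exists>m::int. int n = m * (m + 1) div 2"
    then obtain m :: int where m: "int n = m * (m + 1) div 2" ..
    have "\<exists>i::nat. m * (m + 1) = int i * (int i + 1)"
    proof (cases "m \<ge> 0")
      case True
      then show ?thesis
        by (intro exI[of _ "nat m"]) simp
    next
      \<comment> \<open>The product \<open>m * (m + 1)\<close> is invariant under replacing
        \<open>m\<close> by \<open>- m - 1\<close>, which is nonnegative here.\<close>
      case False
      then show ?thesis
        by (intro exI[of _ "nat (- m - 1)"]) (simp add: algebra_simps)
    qed
    then obtain i :: nat where "m * (m + 1) = int i * (int i + 1)" ..
    then have "int n = int (t i)"
      using m by (simp add: t_def zdiv_int distrib_left)
    then show "\<exists>i. n = t i"
      by auto
  next
    assume "\<exists>i. n = t i"
    then obtain i where "n = t i" ..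
    then have "int n = int i * (int i + 1) div 2"
      by (simp add: t_def zdiv_int distrib_left)
    then show "\<exists>m::int. int n = m * (m + 1) div 2" ..
  qed
  have "int n - int (t i) = 0 \<longleftrightarrow> t i = n" for i
    by auto
  then have sum: "(\<Sum>i\<le>n. if int n - int (t i) = 0 then 1 else 0)
      = int (card ({..n} \<inter> {i. t i = n}))"
    by (simp only: sum.If_cases finite_atMost) simp
  show ?thesis
  proof (cases "\<exists>i. n = t i")
    case True
    then obtain i where i: "n = t i" ..
    then have "{..n} \<inter> {j. t j = n} = {i}"
      using le[of i] inj by (auto simp: inj_eq)
    then show ?thesis
      using True unfolding t_def[symmetric] sum delta_def eq by simp
  next
    case False
    then have "{..n} \<inter> {j. t j = n} = {}"
      by auto
    then show ?thesis
      using False unfolding t_def[symmetric] sum delta_def eq by simp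
  qed
qed

theorem theorem2:
  fixes k n :: nat
  assumes "k \<ge> 1"
  shows "(\<lambda>j::nat. int (M k (int n - int (j * (j + 1) div 2)))) sums
    ((-1) ^ (k - 1) *
      ((\<Sum>j\<in>{- (int k - 1)..int k}.
          (-1) ^ nat \<bar>j\<bar> * int (sigma_mex (int n - j * (3 * j - 1) div 2)))
       - delta (int n)))"
proof -
  let ?J = "{- (int k - 1)..int k}" and ?t = "\<lambda>i::nat. int (i * (i + 1) div 2)"
  \<comment> \<open>Pentagonal numbers are nonnegative also for negative \<open>j\<close>, so
    \<open>sigma_mex_eq\<close> applies with \<open>N = n\<close> throughout.\<close>
  have "j * (3 * j - 1) \<ge> 0" for j :: int
    by (cases "j \<le> 0") (auto intro: mult_nonpos_nonpos)
  then have pent: "int n - j * (3 * j - 1) div 2 \<le> int n" for j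
    by simp
  have "(\<Sum>j\<in>?J. (-1) ^ nat \<bar>j\<bar> * int (sigma_mex (int n - j * (3 * j - 1) div 2)))
      = (\<Sum>j\<in>?J. \<Sum>i\<le>n. (-1) ^ nat \<bar>j\<bar> * pcount (int n - ?t i - j * (3 * j - 1) div 2))"
    unfolding sigma_mex_eq[OF pent] sum_distrib_left
    by (intro sum.cong refl arg_cong2[where f = "(*)"] arg_cong[where f = pcount]) simp
  \<comment> \<open>After swapping, the inner sum over \<open>j\<close> is the truncated pentagonal
    sum at \<open>n\<close> minus a triangular number.\<close>
  also have "\<dots> = (\<Sum>i\<le>n. (if int n - ?t i = 0 then 1 else 0) + (-1) ^ (k - 1) * int (M k (int n - ?t i)))"
    unfolding truncated_pentagonal[OF assms, symmetric] by (rule sum.swap)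
  also have "\<dots> = delta (int n) + (-1) ^ (k - 1) * (\<Sum>i\<le>n. int (M k (int n - ?t i)))"
    unfolding delta_eq by (simp only: sum.distrib sum_distrib_left)
  finally have "(-1) ^ (k - 1) * ((\<Sum>j\<in>?J. (-1) ^ nat \<bar>j\<bar>
        * int (sigma_mex (int n - j * (3 * j - 1) div 2))) - delta (int n))
      = (\<Sum>i\<le>n. int (M k (int n - ?t i)))"
    by (simp add: mult.assoc[symmetric] power_mult_distrib[symmetric])
  moreover have "(\<lambda>i. int (M k (int n - ?t i))) sums (\<Sum>i\<le>n. int (M k (int n - ?t i)))"
  proof (rule sums_finite)
    fix i assume "i \<notin> {..n}"
    \<comment> \<open>From \<open>i \<ge> n + 1\<close> and \<open>i + 1 \<ge> 2\<close>: the
      triangular number exceeds \<open>n\<close>, the argument of \<open>M\<close> is negative, and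
      the series is finite.\<close>
    then have "2 * (n + 1) \<le> i * (i + 1)"
      using mult_le_mono[of "n + 1" i 2 "i + 1"] by auto
    then have "n + 1 \<le> i * (i + 1) div 2"
      by (simp add: less_eq_div_iff_mult_less_eq mult.commute)
    then have "int n - ?t i < 0"
      by linarith
    then show "int (M k (int n - ?t i)) = 0"
      by (simp add: M_eq partitions_neg)
  qed simp
  ultimately show ?thesis
    by simp
qed

end
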